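(* Let $S\subseteq BS(1,2)$ be a finite set of size $k=|S|\ge 1$ and suppose that $S=b^ma^A$, where $m\ge 2$ is an integer and $A\subseteq\mathbb{Z}$ is a finite set of integers. Then $$S^2=b^{2m}a^{A+2^m\ast A}$$ and $$|S^2|=|A+2^m\ast A|\ge\max(4k-4,1)\ge 3k-2.$$
   Context: $BS(1,2)=\langle a,b\mid ab=ba^2\rangle$ is the Baumslag-Solitar group. For finite $A\subseteq\mathbb{Z}$ and an integer $m\ge 0$, $b^ma^A=\{b^ma^x: x\in A\}$. $S^2=\{s_1s_2: s_1,s_2\in S\}$. For a positive integer $r$, $r\ast A=\{rx: x\in A\}$ and $A+r\ast A=\{x+ry: x,y\in A\}$. $|X|$ denotes the size of a finite set $X$. *)

theory Defs
  imports "HOL-Algebra.Coset"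
begin

datatype 'g letter = Pos 'g | Neg 'g

type_synonym 'g word = "'g letter list"

text \<open>
  The free group on the whole type \<open>'g\<close>, modulo the normal closure of all \<open>u v\<inverse>\<close> with
  \<open>(u, v) \<in> R\<close>, is presented as the free monoid on the letters \<open>Pos g\<close>, \<open>Neg g\<close> modulo the least
  congruence that contains \<open>R\<close> and makes \<open>Neg g\<close> a two-sided inverse of \<open>Pos g\<close>.
\<close>

inductive pres_eq :: "('g word \<times> 'g word) set \<Rightarrow> 'g word \<Rightarrow> 'g word \<Rightarrow> bool"
  for R :: "('g word \<times> 'g word) set"
where
  refl: "pres_eq R u u"
| sym: "pres_eq R u v \<Longrightarrow> pres_eq R v u"
| trans: "pres_eq R u v \<Longrightarrow> pres_eq R v w \<Longrightarrow> pres_eq R u w"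
| append: "pres_eq R u u' \<Longrightarrow> pres_eq R v v' \<Longrightarrow> pres_eq R (u @ v) (u' @ v')"
| Pos_Neg: "pres_eq R [Pos g, Neg g] []"
| Neg_Pos: "pres_eq R [Neg g, Pos g] []"
| rel: "(u, v) \<in> R \<Longrightarrow> pres_eq R u v"

definition pres_rel :: "('g word \<times> 'g word) set \<Rightarrow> ('g word \<times> 'g word) set" where
  "pres_rel R = {(u, v). pres_eq R u v}"

definition pres_class :: "('g word \<times> 'g word) set \<Rightarrow> 'g word \<Rightarrow> 'g word set" where
  "pres_class R u = pres_rel R `` {u}"

definition presented_group :: "('g word \<times> 'g word) set \<Rightarrow> 'g word set monoid" where
  "presented_group R =
    \<lparr>carrier = UNIV // pres_rel R,
     mult = (\<lambda>X Y. \<Union>u\<in>X. \<Union>v\<in>Y. pres_class R (u @ v)),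
     one = pres_class R []\<rparr>"

lemma equiv_pres_rel: "equiv UNIV (pres_rel R)"
proof (rule equivI)
  show "pres_rel R \<subseteq> UNIV \<times> UNIV" by simp
  show "refl_on UNIV (pres_rel R)"
    by (simp add: refl_on_def pres_rel_def pres_eq.refl)
  show "sym (pres_rel R)"
    by (simp add: sym_def pres_rel_def pres_eq.sym)
  show "trans (pres_rel R)"
    unfolding trans_def pres_rel_def using pres_eq.trans[of R] by blast
qed

lemma pres_class_eq_iff: "pres_class R u = pres_class R v \<longleftrightarrow> pres_eq R u v"
  using eq_equiv_class_iff[OF equiv_pres_rel, of u v R]
  by (simp add: pres_class_def pres_rel_def)

lemma carrier_presented_group: "carrier (presented_group R) = range (pres_class R)"
  by (auto simp: presented_group_def quotient_def pres_class_def)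

lemma one_presented_group: "\<one>\<^bsub>presented_group R\<^esub> = pres_class R []"
  by (simp add: presented_group_def)

lemma mult_presented_group:
  "pres_class R u \<otimes>\<^bsub>presented_group R\<^esub> pres_class R v = pres_class R (u @ v)"
proof -
  have "pres_class R (u' @ v') = pres_class R (u @ v)"
    if "u' \<in> pres_class R u" "v' \<in> pres_class R v" for u' v'
    using that unfolding pres_class_eq_iff
    by (simp add: pres_class_def pres_rel_def pres_eq.append pres_eq.sym)
  moreover have "u \<in> pres_class R u" "v \<in> pres_class R v"
    by (simp_all add: pres_class_def pres_rel_def pres_eq.refl)
  ultimately show ?thesis
    unfolding presented_group_def monoid.simps by blast
qed

lemma pres_left_inverse: "\<exists>v. pres_eq R (v @ u) []"
proof (induction u)
  case Nil
  then show ?case using pres_eq.refl[of R "[]"] by force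
next
  case (Cons l u)
  then obtain v where v: "pres_eq R (v @ u) []" by blast
  define l' where "l' = (case l of Pos g \<Rightarrow> Neg g | Neg g \<Rightarrow> Pos g)"
  have "pres_eq R [l', l] []"
    unfolding l'_def by (cases l) (auto intro: pres_eq.Pos_Neg pres_eq.Neg_Pos)
  then have "pres_eq R (v @ ([l', l] @ u)) (v @ ([] @ u))"
    by (intro pres_eq.append pres_eq.refl)
  then have "pres_eq R ((v @ [l']) @ (l # u)) []"
    using pres_eq.trans[OF _ v] by simp
  then show ?case by blast
qed

lemma group_presented_group: "group (presented_group R)"
proof (rule groupI)
  fix x assume "x \<in> carrier (presented_group R)"
  then obtain u where u: "x = pres_class R u" by (auto simp: carrier_presented_group)
  obtain v where "pres_eq R (v @ u) []" using pres_left_inverse by blast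
  then show "\<exists>y\<in>carrier (presented_group R). y \<otimes>\<^bsub>presented_group R\<^esub> x = \<one>\<^bsub>presented_group R\<^esub>"
    by (auto simp: u carrier_presented_group one_presented_group mult_presented_group
        pres_class_eq_iff)
qed (auto simp: carrier_presented_group one_presented_group mult_presented_group)

datatype bs_gen = Gen_a | Gen_b

definition bs_rels :: "(bs_gen word \<times> bs_gen word) set" where
  "bs_rels = {([Pos Gen_a, Pos Gen_b], [Pos Gen_b, Pos Gen_a, Pos Gen_a])}"

definition BS12 :: "bs_gen word set monoid" where
  "BS12 = presented_group bs_rels"

definition bs_a :: "bs_gen word set" where
  "bs_a = pres_class bs_rels [Pos Gen_a]"

definition bs_b :: "bs_gen word set" where
  "bs_b = pres_class bs_rels [Pos Gen_b]"

lemma group_BS12: "group BS12"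
  by (simp add: BS12_def group_presented_group)

lemma bs_a_carrier: "bs_a \<in> carrier BS12"
  and bs_b_carrier: "bs_b \<in> carrier BS12"
  by (auto simp: BS12_def bs_a_def bs_b_def carrier_presented_group)

lemma BS12_relation: "bs_a \<otimes>\<^bsub>BS12\<^esub> bs_b = bs_b \<otimes>\<^bsub>BS12\<^esub> bs_a [^]\<^bsub>BS12\<^esub> (2::nat)"
proof -
  interpret group BS12 by (rule group_BS12)
  have "bs_a [^]\<^bsub>BS12\<^esub> (2::nat) = bs_a \<otimes>\<^bsub>BS12\<^esub> bs_a"
    using bs_a_carrier by (simp add: numeral_2_eq_2)
  then show ?thesis
    by (simp add: BS12_def bs_a_def bs_b_def bs_rels_def mult_presented_group pres_class_eq_iff pres_eq.rel)
qed

definition ba_set :: "nat \<Rightarrow> int set \<Rightarrow> bs_gen word set set" where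
  "ba_set m A = {bs_b [^]\<^bsub>BS12\<^esub> m \<otimes>\<^bsub>BS12\<^esub> bs_a [^]\<^bsub>BS12\<^esub> x | x. x \<in> A}"

definition dilate :: "int \<Rightarrow> int set \<Rightarrow> int set" where
  "dilate r A = {r * x | x. x \<in> A}"

definition sumset :: "int set \<Rightarrow> int set \<Rightarrow> int set" where
  "sumset A B = {x + y | x y. x \<in> A \<and> y \<in> B}"

end

theory Submission
  imports Defs Complex_Main
begin

text \<open>
  Acting on the rationals by \<open>a x = x + 1\<close>, \<open>b x = x / 2\<close> shows that \<open>a\<close> has infinite order, and
  \<open>a\<^sup>x b\<^sup>m = b\<^sup>m a\<^bsup>r x\<^esup>\<close> with \<open>r = 2\<^sup>m\<close>; so everything reduces to \<open>|A + r * A| \<ge> 4|A| - 4\<close>, which is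
  proved by induction on \<open>|A|\<close>. An affine change of variables makes \<open>A\<close> contain both parities.
  Splitting \<open>A\<close> into its \<open>s\<close> classes modulo \<open>r\<close> gives \<open>|A + r * A| \<ge> |A| + s(|A| - 1)\<close>, which suffices
  for \<open>s \<ge> 3\<close>. If \<open>s = 2\<close>, the classes are the even part and the odd part of \<open>A\<close>. For such a part \<open>X\<close>
  with complement \<open>Y\<close>, either \<open>X + r * Y\<close> has \<open>|Y|\<close> elements that are incongruent modulo \<open>r\<^sup>2\<close> to all of
  \<open>X + r * X\<close>, or \<open>X\<close> modulo \<open>r\<^sup>2\<close> is closed under a translation by \<open>r\<close> times an odd number. In the
  latter case \<open>X\<close> meets \<open>r\<close> classes modulo \<open>r\<^sup>2\<close>, which makes \<open>X + r * X\<close> itself large.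
\<close>

subsection \<open>Sumsets of integers\<close>

lemma sumset_eq_image: "sumset A B = (\<lambda>(x, y). x + y) ` (A \<times> B)"
  by (auto simp: sumset_def image_iff)

lemma dilate_eq_image: "dilate r A = (*) r ` A"
  by (auto simp: dilate_def)

lemma sumsetI: "x \<in> A \<Longrightarrow> y \<in> B \<Longrightarrow> x + y \<in> sumset A B"
  by (auto simp: sumset_def)

lemma finite_sumset [simp]: "finite A \<Longrightarrow> finite B \<Longrightarrow> finite (sumset A B)"
  by (simp add: sumset_eq_image)

lemma finite_dilate [simp]: "finite A \<Longrightarrow> finite (dilate r A)"
  by (simp add: dilate_eq_image)

lemma card_dilate: "r \<noteq> 0 \<Longrightarrow> card (dilate r A) = card A"
  by (simp add: dilate_eq_image card_image inj_on_def)

lemma sumset_mono: "A \<subseteq> A' \<Longrightarrow> B \<subseteq> B' \<Longrightarrow> sumset A B \<subseteq> sumset A' B'"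
  by (auto simp: sumset_def)

lemma dilate_mono: "A \<subseteq> B \<Longrightarrow> dilate r A \<subseteq> dilate r B"
  by (auto simp: dilate_def)

text \<open>The translates \<open>X + Min Y\<close> and \<open>Max X + Y\<close> lie inside the
  sumset and can meet only in \<open>Max X + Min Y\<close>.\<close>

lemma card_sumset_ge:
  assumes "finite X" "finite Y" "X \<noteq> {}" "Y \<noteq> {}"
  shows "int (card (sumset X Y)) \<ge> int (card X) + int (card Y) - 1"
proof -
  define P where "P = (\<lambda>x. x + Min Y) ` X"
  define Q where "Q = (\<lambda>y. Max X + y) ` Y"
  have fin: "finite P" "finite Q" using assms by (auto simp: P_def Q_def)
  have "P \<inter> Q \<subseteq> {Max X + Min Y}"
  proof
    fix z assume "z \<in> P \<inter> Q"
    then obtain x y where *: "x \<in> X" "y \<in> Y" "z = x + Min Y" "z = Max X + y"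
      by (auto simp: P_def Q_def)
    have "x \<le> Max X" "Min Y \<le> y" using assms * by auto
    with * show "z \<in> {Max X + Min Y}" by simp
  qed
  then have "card (P \<inter> Q) \<le> 1"
    by (metis card_mono card.empty card_insert_disjoint empty_iff finite.emptyI finite_insert One_nat_def)
  moreover have "card P = card X" "card Q = card Y"
    by (auto simp: P_def Q_def card_image inj_on_def)
  moreover have "card P + card Q = card (P \<union> Q) + card (P \<inter> Q)"
    using fin by (rule card_Un_Int)
  moreover have "P \<union> Q \<subseteq> sumset X Y"
    using assms by (auto simp: P_def Q_def intro!: sumsetI Min_in Max_in)
  then have "card (P \<union> Q) \<le> card (sumset X Y)"
    using assms by (intro card_mono) auto
  ultimately show ?thesis by linarith
qed

text \<open>Since \<open>Y\<close> sits in one class modulo \<open>n\<close>, the sumsets of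
  \<open>Y\<close> with different residue classes of \<open>X\<close> are disjoint. Applying the
  elementary bound to each class gains \<open>card Y - 1\<close> once per class.\<close>

lemma card_sumset_ge_residues:
  fixes n :: int
  assumes "finite X" "finite Y" "Y \<noteq> {}"
    and Y: "\<And>y y'. y \<in> Y \<Longrightarrow> y' \<in> Y \<Longrightarrow> y mod n = y' mod n"
  shows "int (card (sumset X Y)) \<ge>
    int (card X) + int (card ((\<lambda>x. x mod n) ` X)) * (int (card Y) - 1)"
proof -
  define R where "R = (\<lambda>x. x mod n) ` X"
  define C where "C c = {x \<in> X. x mod n = c}" for c
  have fin: "finite R" "\<And>c. finite (C c)" using assms by (auto simp: R_def C_def)
  have X: "X = (\<Union>c\<in>R. C c)" by (auto simp: R_def C_def)
  have cX: "card X = (\<Sum>c\<in>R. card (C c))"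
    by (subst X, rule card_UN_disjoint) (use fin in \<open>auto simp: C_def\<close>)
  have "sumset X Y = (\<Union>c\<in>R. sumset (C c) Y)"
    by (subst X) (auto simp: sumset_def)
  moreover have "sumset (C c) Y \<inter> sumset (C d) Y = {}" if "c \<noteq> d" for c d
  proof (rule ccontr)
    assume "sumset (C c) Y \<inter> sumset (C d) Y \<noteq> {}"
    then obtain x y x' y' where *: "x \<in> C c" "x' \<in> C d" "y \<in> Y" "y' \<in> Y" "x + y = x' + y'"
      by (auto simp: sumset_def)
    have "n dvd y' - y" using Y[OF *(4) *(3)] by (simp add: mod_eq_dvd_iff)
    also have "y' - y = x - x'" using *(5) by simp
    finally have "x mod n = x' mod n" by (simp add: mod_eq_dvd_iff)
    with * that show False by (simp add: C_def)
  qed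
  ultimately have "card (sumset X Y) = (\<Sum>c\<in>R. card (sumset (C c) Y))"
    using fin assms by (simp add: card_UN_disjoint)
  then have "int (card (sumset X Y)) = (\<Sum>c\<in>R. int (card (sumset (C c) Y)))" by simp
  also have "\<dots> \<ge> (\<Sum>c\<in>R. int (card (C c)) + (int (card Y) - 1))"
  proof (rule sum_mono)
    fix c assume "c \<in> R"
    then have "C c \<noteq> {}" by (auto simp: R_def C_def)
    then show "int (card (C c)) + (int (card Y) - 1) \<le> int (card (sumset (C c) Y))"
      using card_sumset_ge[of "C c" Y] fin assms by simp
  qed
  finally show ?thesis
    by (simp add: cX sum.distrib R_def)
qed

section \<open>Affine normalisation\<close>

text \<open>The substitution \<open>x \<mapsto> a + g * x\<close> turns \<open>x + r * y\<close>
  into \<open>(a + r * a) + g * (x + r * y)\<close>, an injective affine image.\<close>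

lemma card_sumset_affine:
  assumes "g \<noteq> 0"
  shows "card (sumset ((\<lambda>x. a + g * x) ` B) (dilate r ((\<lambda>x. a + g * x) ` B))) =
    card (sumset B (dilate r B))"
proof -
  have eq: "(a + g * x) + r * (a + g * y) = (a + r * a) + g * (x + r * y)" for x y
    by (simp add: algebra_simps)
  have "sumset ((\<lambda>x. a + g * x) ` B) (dilate r ((\<lambda>x. a + g * x) ` B)) =
      (\<lambda>(x, y). (a + g * x) + r * (a + g * y)) ` (B \<times> B)"
    by (auto simp: sumset_def dilate_def)
  also have "\<dots> = (\<lambda>x. (a + r * a) + g * x) ` (\<lambda>(x, y). x + r * y) ` (B \<times> B)"
    unfolding eq image_image by (rule image_cong) auto
  also have "(\<lambda>(x, y). x + r * y) ` (B \<times> B) = sumset B (dilate r B)"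
    by (auto simp: sumset_def dilate_def)
  finally have "sumset ((\<lambda>x. a + g * x) ` B) (dilate r ((\<lambda>x. a + g * x) ` B)) =
      (\<lambda>x. (a + r * a) + g * x) ` sumset B (dilate r B)" .
  then show ?thesis
    using assms by (simp add: card_image inj_on_def)
qed

text \<open>Translate by some \<open>a\<close> in \<open>A\<close> and divide by the gcd
  \<open>g\<close> of the differences. The element \<open>a\<close> becomes 0, which is even; if all
  quotients were even, \<open>2 * g\<close> would divide every difference and hence
  \<open>g\<close>.\<close>

lemma affine_image_of_both_parities:
  fixes A :: "int set"
  assumes "finite A" "card A \<ge> 2"
  obtains a g B where "g \<noteq> 0" "A = (\<lambda>x. a + g * x) ` B" "\<exists>x\<in>B. even x" "\<exists>x\<in>B. odd x"
proof -
  obtain a where a: "a \<in> A" using assms by fastforce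
  define g where "g = Gcd ((\<lambda>x. x - a) ` A)"
  define B where "B = (\<lambda>x. (x - a) div g) ` A"
  have "\<not> A \<subseteq> {a}"
  proof
    assume "A \<subseteq> {a}"
    from card_mono[OF _ this] assms show False by simp
  qed
  then have g: "g \<noteq> 0" by (auto simp: g_def)
  have dvd: "g dvd x - a" if "x \<in> A" for x using that by (auto simp: g_def)
  then have eq: "a + g * ((x - a) div g) = x" if "x \<in> A" for x using that by simp
  have AB: "A = (\<lambda>x. a + g * x) ` B"
    by (simp add: B_def image_image eq cong: image_cong)
  have "\<exists>x\<in>B. odd x"
  proof (rule ccontr)
    assume "\<not> (\<exists>x\<in>B. odd x)"
    then have even: "even ((y - a) div g)" if "y \<in> A" for y
      using that by (auto simp: B_def)
    have "g * 2 dvd y - a" if "y \<in> A" for y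
    proof -
      have "g * 2 dvd g * ((y - a) div g)" using even[OF that] by (intro mult_dvd_mono) auto
      then show ?thesis using dvd[OF that] by simp
    qed
    then have "g * 2 dvd g"
      unfolding g_def by (intro Gcd_greatest) auto
    with g show False by simp
  qed
  moreover have "0 \<in> B" using a by (force simp: B_def)
  then have "\<exists>x\<in>B. even x" by (intro bexI[of _ 0]) auto
  ultimately show ?thesis using that g AB by blast
qed

section \<open>Residue classes modulo the square of r\<close>

text \<open>Closure keeps the orbit \<open>x0 + j * (r * d)\<close> inside the residues of
  \<open>X\<close>, and its first \<open>r\<close> terms are pairwise incongruent modulo
  \<open>r * r\<close>.\<close>

lemma residues_ge_of_translation_closed:
  fixes d :: int and m :: nat
  defines "r \<equiv> 2 ^ m"
  assumes "odd d" "finite X" "X \<noteq> {}"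
    and closed: "\<And>x. x \<in> X \<Longrightarrow> \<exists>x'\<in>X. (x + r * d) mod r\<^sup>2 = x' mod r\<^sup>2"
  shows "int (card ((\<lambda>x. x mod r\<^sup>2) ` X)) \<ge> r"
proof -
  obtain x0 where x0: "x0 \<in> X" using assms by blast
  have r: "r > 0" by (simp add: r_def)
  have orbit: "(x0 + int j * (r * d)) mod r\<^sup>2 \<in> (\<lambda>x. x mod r\<^sup>2) ` X" for j
  proof (induction j)
    case 0
    then show ?case using x0 by simp
  next
    case (Suc j)
    then obtain x where x: "x \<in> X" "(x0 + int j * (r * d)) mod r\<^sup>2 = x mod r\<^sup>2" by blast
    then have "(x0 + int j * (r * d) + r * d) mod r\<^sup>2 = (x + r * d) mod r\<^sup>2"
      by (intro mod_add_cong) auto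
    then show ?case using closed[OF x(1)] by (auto simp: algebra_simps)
  qed
  have "inj_on (\<lambda>j. (x0 + int j * (r * d)) mod r\<^sup>2) {..<nat r}"
  proof (rule inj_onI)
    fix i j assume ij: "i \<in> {..<nat r}" "j \<in> {..<nat r}"
      and "(x0 + int i * (r * d)) mod r\<^sup>2 = (x0 + int j * (r * d)) mod r\<^sup>2"
    then have "r\<^sup>2 dvd (x0 + int i * (r * d)) - (x0 + int j * (r * d))"
      by (simp add: mod_eq_dvd_iff)
    then have "r * r dvd r * ((int i - int j) * d)"
      by (simp add: algebra_simps power2_eq_square)
    then have "r dvd (int i - int j) * d" using r by simp
    \<comment> \<open>As \<open>r\<close> is a power of two, oddness of \<open>d\<close> allows
      cancelling it.\<close>
    moreover have "coprime r d" using \<open>odd d\<close> by (simp add: r_def)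
    ultimately have "r dvd int i - int j" by (simp add: coprime_dvd_mult_left_iff)
    moreover have "\<bar>int i - int j\<bar> < r" using ij by auto
    ultimately show "i = j"
      using dvd_imp_le_int[of "int i - int j" r] r by fastforce
  qed
  then have "card {..<nat r} \<le> card ((\<lambda>x. x mod r\<^sup>2) ` X)"
    using orbit \<open>finite X\<close> by (intro card_inj_on_le) auto
  then show ?thesis using r by simp
qed

text \<open>One parity class \<open>X\<close> with the other class \<open>Y\<close>, where
  \<open>IH\<close> is the induction hypothesis for \<open>X\<close>. If translation by
  \<open>r * (a2 - a1)\<close> moves some \<open>x\<close> off \<open>X\<close> modulo
  \<open>r * r\<close>, then \<open>x + r * Y\<close> adds \<open>card Y\<close> new sums. Otherwise
  \<open>X\<close> meets at least \<open>r \<ge> 4\<close> classes, and the residue bound gives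
  \<open>card X + 4 * (card X - 1)\<close>.\<close>

lemma card_sumset_residue_class:
  fixes m :: nat
  defines "r \<equiv> (2::int) ^ m"
  assumes "m \<ge> 2" "finite X" "finite Y" "X \<noteq> {}" "Y \<noteq> {}"
    and X: "\<And>x x'. x \<in> X \<Longrightarrow> x' \<in> X \<Longrightarrow> x mod r = x' mod r"
    and Y: "\<And>y y'. y \<in> Y \<Longrightarrow> y' \<in> Y \<Longrightarrow> y mod r = y' mod r"
    and odd: "\<And>x y. x \<in> X \<Longrightarrow> y \<in> Y \<Longrightarrow> odd (y - x)"
    and IH: "int (card (sumset X (dilate r X))) \<ge> 4 * int (card X) - 4"
  shows "int (card (sumset X (dilate r (X \<union> Y)))) \<ge> 4 * int (card X) - 4 + int (card Y) \<or>
    card X \<ge> 4 \<and> int (card (sumset X (dilate r (X \<union> Y)))) \<ge> 5 * int (card X) - 4"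
proof -
  have r4: "r \<ge> 4"
    using power_increasing[of 2 m "2::int"] \<open>m \<ge> 2\<close> by (simp add: r_def)
  have XX: "sumset X (dilate r X) \<subseteq> sumset X (dilate r (X \<union> Y))"
    by (intro sumset_mono dilate_mono) auto
  have fin: "finite (sumset X (dilate r (X \<union> Y)))" using assms by auto
  \<comment> \<open>Modulo \<open>r * r\<close>, the number \<open>r * (a2 - a1)\<close> does not
    depend on these choices, because \<open>X\<close> and \<open>Y\<close> each lie in one class
    modulo \<open>r\<close>.\<close>
  obtain a1 a2 where a: "a1 \<in> X" "a2 \<in> Y" using assms by blast
  have rX: "(r * x) mod r\<^sup>2 = (r * x') mod r\<^sup>2" if "x \<in> X" "x' \<in> X" for x x'
    using X[OF that] by (metis mult_mod_right power2_eq_square)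
  show ?thesis
  proof (cases "\<forall>x\<in>X. \<exists>x'\<in>X. (x + r * (a2 - a1)) mod r\<^sup>2 = x' mod r\<^sup>2")
    case True
    have D: "int (card ((\<lambda>x. x mod r\<^sup>2) ` X)) \<ge> r"
      using residues_ge_of_translation_closed[of "a2 - a1" X m, folded r_def]
        True odd[OF a] \<open>finite X\<close> \<open>X \<noteq> {}\<close> by blast
    moreover have "card ((\<lambda>x. x mod r\<^sup>2) ` X) \<le> card X" using assms by (intro card_image_le)
    ultimately have k: "card X \<ge> 4" using r4 by linarith
    have "int (card X) + int (card ((\<lambda>x. x mod r\<^sup>2) ` X)) * (int (card (dilate r X)) - 1)
        \<le> int (card (sumset X (dilate r X)))"
    proof (rule card_sumset_ge_residues)
      show "y mod r\<^sup>2 = y' mod r\<^sup>2" if "y \<in> dilate r X" "y' \<in> dilate r X" for y y'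
        using that rX unfolding dilate_def by blast
    qed (use \<open>finite X\<close> \<open>X \<noteq> {}\<close> in \<open>auto simp: dilate_def\<close>)
    moreover have "card (dilate r X) = card X" using r4 by (simp add: card_dilate)
    moreover have "4 * (int (card X) - 1) \<le>
        int (card ((\<lambda>x. x mod r\<^sup>2) ` X)) * (int (card X) - 1)"
      using D r4 k by (intro mult_right_mono) auto
    moreover have "card (sumset X (dilate r X)) \<le> card (sumset X (dilate r (X \<union> Y)))"
      using fin XX by (rule card_mono)
    ultimately show ?thesis using k by simp
  next
    case False
    then obtain x where x: "x \<in> X"
      "\<And>x'. x' \<in> X \<Longrightarrow> (x + r * (a2 - a1)) mod r\<^sup>2 \<noteq> x' mod r\<^sup>2" by blast
    \<comment> \<open>A common element \<open>x + r * y = x' + r * y'\<close> would make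
      \<open>x + r * (a2 - a1)\<close> congruent to \<open>x'\<close> modulo \<open>r * r\<close>,
      against the choice of \<open>x\<close>.\<close>
    have "(\<lambda>y. x + r * y) ` Y \<inter> sumset X (dilate r X) = {}"
    proof (rule ccontr)
      assume "(\<lambda>y. x + r * y) ` Y \<inter> sumset X (dilate r X) \<noteq> {}"
      then obtain y x' y' where *: "y \<in> Y" "x' \<in> X" "y' \<in> X" "x + r * y = x' + r * y'"
        by (auto simp: sumset_def dilate_def)
      have "r dvd a2 - y" "r dvd a1 - y'"
        using X Y a * by (metis mod_eq_dvd_iff)+
      then have "r * r dvd r * ((a2 - y) - (a1 - y'))" by simp
      moreover have "r * ((a2 - y) - (a1 - y')) = (x + r * (a2 - a1)) - x'"
        using *(4) by (simp add: algebra_simps)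
      ultimately show False
        using x(2)[OF *(2)] by (simp add: mod_eq_dvd_iff power2_eq_square)
    qed
    then have "card ((\<lambda>y. x + r * y) ` Y \<union> sumset X (dilate r X)) =
        card ((\<lambda>y. x + r * y) ` Y) + card (sumset X (dilate r X))"
      using \<open>finite X\<close> \<open>finite Y\<close> by (intro card_Un_disjoint) auto
    moreover have "card ((\<lambda>y. x + r * y) ` Y) = card Y"
      using r4 by (simp add: card_image inj_on_def)
    moreover have "(\<lambda>y. x + r * y) ` Y \<subseteq> sumset X (dilate r (X \<union> Y))"
      using x(1) by (auto simp: sumset_def dilate_def)
    with XX have "card ((\<lambda>y. x + r * y) ` Y \<union> sumset X (dilate r X)) \<le>
        card (sumset X (dilate r (X \<union> Y)))"
      using fin by (intro card_mono) auto
    ultimately show ?thesis using IH by linarith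
  qed
qed

section \<open>The lower bound for a set plus its dilate\<close>

lemma card_sumset_dilate_ge:
  fixes A :: "int set" and m :: nat
  assumes "m \<ge> 2" "finite A"
  shows "int (card (sumset A (dilate (2 ^ m) A))) \<ge> 4 * int (card A) - 4"
  using assms(2)
proof (induction "card A" arbitrary: A rule: less_induct)
  case less
  define r where "r = (2::int) ^ m"
  have r4: "r \<ge> 4"
    using power_increasing[of 2 m "2::int"] \<open>m \<ge> 2\<close> by (simp add: r_def)
  show ?case
  proof (cases "card A \<ge> 2")
    case False
    then show ?thesis by simp
  next
    case True
    obtain a g B where g: "g \<noteq> 0" and AB: "A = (\<lambda>x. a + g * x) ` B"
      and parities: "\<exists>x\<in>B. even x" "\<exists>x\<in>B. odd x"
      using affine_image_of_both_parities[OF less.prems True] by metis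
    have inj: "inj_on (\<lambda>x. a + g * x) B" using g by (auto simp: inj_on_def)
    have cB: "card B = card A" by (simp add: AB card_image[OF inj])
    have fB: "finite B" using less.prems finite_image_iff[OF inj] by (simp add: AB)
    define E where "E = {x \<in> B. even x}"
    define F where "F = {x \<in> B. odd x}"
    have B: "B = E \<union> F" "E \<inter> F = {}" and ne: "E \<noteq> {}" "F \<noteq> {}" and fin: "finite E" "finite F"
      using parities fB by (auto simp: E_def F_def)
    have cEF: "card B = card E + card F" using B fin by (simp add: card_Un_disjoint)
    have pos: "card E > 0" "card F > 0" using ne fin by (simp_all add: card_gt_0_iff)
    have "int (card (sumset B (dilate r B))) \<ge> 4 * int (card B) - 4"
    \<comment> \<open>\<open>dilate r B\<close> lies in the class 0 modulo \<open>r\<close>, so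
      three residues of \<open>B\<close> already yield
      \<open>card B + 3 * (card B - 1)\<close>.\<close>
    proof (cases "card ((\<lambda>x. x mod r) ` B) \<ge> 3")
      case True
      have "int (card B) + int (card ((\<lambda>x. x mod r) ` B)) * (int (card (dilate r B)) - 1)
          \<le> int (card (sumset B (dilate r B)))"
        by (rule card_sumset_ge_residues) (use fB parities in \<open>auto simp: dilate_def\<close>)
      moreover have "card (dilate r B) = card B" using r4 by (simp add: card_dilate)
      moreover have "3 * (int (card B) - 1) \<le> int (card ((\<lambda>x. x mod r) ` B)) * (int (card B) - 1)"
        using True cEF pos by (intro mult_right_mono) auto
      ultimately show ?thesis by simp
    next
      case False
      let ?R = "\<lambda>X. (\<lambda>x. x mod r) ` X"
      have "even r" using \<open>m \<ge> 2\<close> by (simp add: r_def)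
      then have par: "even (x mod r) \<longleftrightarrow> even x" for x by (simp add: dvd_mod_iff)
      \<comment> \<open>Reduction modulo the even \<open>r\<close> preserves parity. With at most
        two residues in total, \<open>E\<close> and \<open>F\<close> therefore have exactly one
        each.\<close>
      have "?R E \<inter> ?R F = {}" 
        by (auto simp: E_def F_def) (metis par)
      then have "card (?R B) = card (?R E) + card (?R F)"
        using fin by (simp add: B image_Un card_Un_disjoint)
      moreover have "card (?R E) > 0" "card (?R F) > 0" using ne fin by (simp_all add: card_gt_0_iff)
      ultimately have "card (?R E) = 1" "card (?R F) = 1" using False by linarith+
      then obtain e f where ef: "?R E = {e}" "?R F = {f}" by (meson card_1_singletonE)
      have modE: "x mod r = x' mod r" if "x \<in> E" "x' \<in> E" for x x'
        using ef(1) that by (metis image_eqI singletonD)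
      have modF: "x mod r = x' mod r" if "x \<in> F" "x' \<in> F" for x x'
        using ef(2) that by (metis image_eqI singletonD)
      have IH: "int (card (sumset E (dilate r E))) \<ge> 4 * int (card E) - 4"
        "int (card (sumset F (dilate r F))) \<ge> 4 * int (card F) - 4"
        unfolding r_def using less.hyps[of E] less.hyps[of F] fin cEF pos cB by auto
      have odd: "odd (y - x)" "odd (x - y)" if "x \<in> E" "y \<in> F" for x y
        using that by (auto simp: E_def F_def)
      have ineqE: "int (card (sumset E (dilate r B))) \<ge> 4 * int (card E) - 4 + int (card F) \<or>
          card E \<ge> 4 \<and> int (card (sumset E (dilate r B))) \<ge> 5 * int (card E) - 4"
        using card_sumset_residue_class[of m E F] assms(1) fin ne modE modF odd IH
        unfolding r_def B(1) by blast
      have ineqF: "int (card (sumset F (dilate r B))) \<ge> 4 * int (card F) - 4 + int (card E) \<or>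
          card F \<ge> 4 \<and> int (card (sumset F (dilate r B))) \<ge> 5 * int (card F) - 4"
        using card_sumset_residue_class[of m F E] assms(1) fin ne modE modF odd IH
        unfolding r_def B(1) Un_commute[of E F] by blast
      have rB: "finite (dilate r B)" "dilate r B \<noteq> {}"
        using fB parities by (auto simp: dilate_def)
      have crB: "card (dilate r B) = card B" using r4 by (simp add: card_dilate)
      \<comment> \<open>These bounds serve the sets with fewer than four elements: sizes 1 and 1
        give 2 + 2 = 4; for sizes 1 and 2 the singleton contributes 3 and the pair 4 * 2 - 4 + 1 =
        5, which is exactly 8.\<close>
      have triv: "int (card (sumset E (dilate r B))) \<ge> int (card E) + int (card B) - 1"
        "int (card (sumset F (dilate r B))) \<ge> int (card F) + int (card B) - 1"
        using card_sumset_ge[of _ "dilate r B"] fin ne rB crB by force+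
      have "sumset B (dilate r B) = sumset E (dilate r B) \<union> sumset F (dilate r B)"
        by (subst (1) B) (auto simp: sumset_def)
      moreover have "sumset E (dilate r B) \<inter> sumset F (dilate r B) = {}"
      proof -
        have "even z" if "z \<in> sumset E (dilate r B)" for z
          using that \<open>even r\<close> by (auto simp: sumset_def dilate_def E_def)
        moreover have "odd z" if "z \<in> sumset F (dilate r B)" for z
          using that \<open>even r\<close> by (auto simp: sumset_def dilate_def F_def)
        ultimately show ?thesis by blast
      qed
      ultimately have "card (sumset B (dilate r B)) =
          card (sumset E (dilate r B)) + card (sumset F (dilate r B))"
        using fin rB by (simp add: card_Un_disjoint)
      \<comment> \<open>From four elements on, \<open>ineqE\<close> and \<open>ineqF\<close>
        suffice: if both take the first alternative, or both the second, the sum is at least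
        \<open>5 * card B - 8\<close>; in a mixed case the class of size at least 4 makes up the
        difference.\<close>
      moreover have "card E + card F \<ge> 4 \<or> card E = 1 \<and> card F \<le> 2 \<or> card E = 2 \<and> card F = 1"
        using pos by linarith
      ultimately show ?thesis
        using ineqE ineqF triv cEF pos by (elim disjE) linarith+
    qed
    then show ?thesis
      using card_sumset_affine[OF g, of a B r] cB by (simp add: AB r_def)
  qed
qed

subsection \<open>The group \<open>BS(1,2)\<close>\<close>

text \<open>The defining relation holds because \<open>a b\<close> and \<open>b a a\<close> both act
  as \<open>x \<mapsto> x / 2 + 1\<close>.\<close>

fun letter_action :: "bs_gen letter \<Rightarrow> rat \<Rightarrow> rat" where
  "letter_action (Pos Gen_a) x = x + 1"
| "letter_action (Neg Gen_a) x = x - 1"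
| "letter_action (Pos Gen_b) x = x / 2"
| "letter_action (Neg Gen_b) x = 2 * x"

text \<open>With \<open>foldr\<close> the rightmost letter acts first, so concatenation of words
  becomes composition of maps.\<close>

definition word_action :: "bs_gen word \<Rightarrow> rat \<Rightarrow> rat" where
  "word_action = foldr letter_action"

lemma word_action_eq:
  assumes "pres_eq bs_rels u v"
  shows "word_action u = word_action v"
  using assms
proof induction
  case (Pos_Neg g)
  then show ?case by (cases g) (auto simp: word_action_def fun_eq_iff)
next
  case (Neg_Pos g)
  then show ?case by (cases g) (auto simp: word_action_def fun_eq_iff)
next
  case (rel u v)
  then show ?case by (auto simp: word_action_def bs_rels_def fun_eq_iff field_simps)
qed (auto simp: word_action_def fun_eq_iff)

interpretation BS12: group BS12
  by (rule group_BS12)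

lemmas [simp] = bs_a_carrier bs_b_carrier

lemma bs_a_nat_pow: "bs_a [^]\<^bsub>BS12\<^esub> n = pres_class bs_rels (replicate n (Pos Gen_a))" for n :: nat
proof (induction n)
  case 0
  then show ?case by (simp add: BS12_def one_presented_group)
next
  case (Suc n)
  have "bs_a [^]\<^bsub>BS12\<^esub> Suc n = bs_a [^]\<^bsub>BS12\<^esub> n \<otimes>\<^bsub>BS12\<^esub> bs_a" by simp
  also have "\<dots> = pres_class bs_rels (replicate n (Pos Gen_a) @ [Pos Gen_a])"
    unfolding Suc by (simp add: BS12_def bs_a_def mult_presented_group)
  finally show ?case by (simp add: replicate_append_same)
qed

text \<open>The \<open>n\<close>-th power of \<open>a\<close> sends 0 to \<open>n\<close>, while the
  identity fixes 0.\<close>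

lemma bs_a_nat_pow_eq_one:
  fixes n :: nat
  assumes "bs_a [^]\<^bsub>BS12\<^esub> n = \<one>\<^bsub>BS12\<^esub>"
  shows "n = 0"
proof -
  have "pres_eq bs_rels (replicate n (Pos Gen_a)) []"
    using assms by (simp add: bs_a_nat_pow) (simp add: BS12_def one_presented_group pres_class_eq_iff)
  then have "word_action (replicate n (Pos Gen_a)) 0 = 0"
    using word_action_eq by (fastforce simp: word_action_def)
  moreover have "word_action (replicate n (Pos Gen_a)) 0 = of_nat n"
    by (induction n) (auto simp: word_action_def)
  ultimately show ?thesis by simp
qed

lemma inj_bs_a_pow: "inj (\<lambda>x::int. bs_a [^]\<^bsub>BS12\<^esub> x)"
proof (rule linorder_injI)
  fix x y :: int assume "x < y"
  show "bs_a [^]\<^bsub>BS12\<^esub> x \<noteq> bs_a [^]\<^bsub>BS12\<^esub> y"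
  proof
    assume "bs_a [^]\<^bsub>BS12\<^esub> x = bs_a [^]\<^bsub>BS12\<^esub> y"
    then have "bs_a [^]\<^bsub>BS12\<^esub> (y - x) = \<one>\<^bsub>BS12\<^esub>"
      by (simp add: BS12.int_pow_diff)
    moreover have "bs_a [^]\<^bsub>BS12\<^esub> (y - x) = bs_a [^]\<^bsub>BS12\<^esub> nat (y - x)"
      using \<open>x < y\<close> int_pow_int[of BS12 bs_a "nat (y - x)"] by simp
    ultimately have "nat (y - x) = 0" by (intro bs_a_nat_pow_eq_one) metis
    with \<open>x < y\<close> show False by simp
  qed
qed

section \<open>Commuting powers of a past powers of b\<close>

text \<open>Conjugation by \<open>b\<close> is an endomorphism taking \<open>a\<close> to its
  square, so it doubles every exponent of \<open>a\<close>, negative ones included.\<close>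

lemma bs_a_pow_mult_bs_b:
  fixes x :: int
  shows "bs_a [^]\<^bsub>BS12\<^esub> x \<otimes>\<^bsub>BS12\<^esub> bs_b = bs_b \<otimes>\<^bsub>BS12\<^esub> bs_a [^]\<^bsub>BS12\<^esub> (2 * x)"
proof -
  let ?c = "\<lambda>g. inv\<^bsub>BS12\<^esub> bs_b \<otimes>\<^bsub>BS12\<^esub> g \<otimes>\<^bsub>BS12\<^esub> bs_b"
  have cancel: "bs_b \<otimes>\<^bsub>BS12\<^esub> (inv\<^bsub>BS12\<^esub> bs_b \<otimes>\<^bsub>BS12\<^esub> z) = z" if "z \<in> carrier BS12" for z
    using that by (simp flip: BS12.m_assoc)
  have hom: "?c \<in> hom BS12 BS12"
    by (rule homI) (simp_all add: BS12.m_assoc cancel)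
  have "?c bs_a = bs_a [^]\<^bsub>BS12\<^esub> (2::nat)"
    by (simp add: BS12.m_assoc BS12_relation BS12.inv_solve_left')
  then have "?c (bs_a [^]\<^bsub>BS12\<^esub> x) = (bs_a [^]\<^bsub>BS12\<^esub> (2::int)) [^]\<^bsub>BS12\<^esub> x"
    using hom_int_pow[OF hom bs_a_carrier group_BS12 group_BS12, of x] int_pow_int[of BS12 bs_a 2]
    by simp
  also have "\<dots> = bs_a [^]\<^bsub>BS12\<^esub> (2 * x)" by (simp add: BS12.int_pow_pow)
  finally show ?thesis
    by (simp add: BS12.m_assoc BS12.inv_solve_left')
qed

lemma bs_a_pow_mult_bs_b_pow:
  fixes x :: int and m :: nat
  shows "bs_a [^]\<^bsub>BS12\<^esub> x \<otimes>\<^bsub>BS12\<^esub> bs_b [^]\<^bsub>BS12\<^esub> m =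
    bs_b [^]\<^bsub>BS12\<^esub> m \<otimes>\<^bsub>BS12\<^esub> bs_a [^]\<^bsub>BS12\<^esub> (2 ^ m * x)"
proof (induction m)
  case 0
  then show ?case by simp
next
  case (Suc m)
  have "bs_a [^]\<^bsub>BS12\<^esub> x \<otimes>\<^bsub>BS12\<^esub> bs_b [^]\<^bsub>BS12\<^esub> Suc m =
      (bs_a [^]\<^bsub>BS12\<^esub> x \<otimes>\<^bsub>BS12\<^esub> bs_b [^]\<^bsub>BS12\<^esub> m) \<otimes>\<^bsub>BS12\<^esub> bs_b"
    by (simp add: BS12.m_assoc)
  also have "\<dots> = bs_b [^]\<^bsub>BS12\<^esub> m \<otimes>\<^bsub>BS12\<^esub> (bs_b \<otimes>\<^bsub>BS12\<^esub> bs_a [^]\<^bsub>BS12\<^esub> (2 * (2 ^ m * x)))"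
    by (simp add: Suc BS12.m_assoc bs_a_pow_mult_bs_b)
  finally show ?case by (simp add: BS12.m_assoc mult.assoc)
qed

lemma ba_mult_ba:
  fixes x y :: int and m n :: nat
  shows "(bs_b [^]\<^bsub>BS12\<^esub> m \<otimes>\<^bsub>BS12\<^esub> bs_a [^]\<^bsub>BS12\<^esub> x) \<otimes>\<^bsub>BS12\<^esub>
      (bs_b [^]\<^bsub>BS12\<^esub> n \<otimes>\<^bsub>BS12\<^esub> bs_a [^]\<^bsub>BS12\<^esub> y) =
    bs_b [^]\<^bsub>BS12\<^esub> (m + n) \<otimes>\<^bsub>BS12\<^esub> bs_a [^]\<^bsub>BS12\<^esub> (y + 2 ^ n * x)"
proof -
  have "(bs_b [^]\<^bsub>BS12\<^esub> m \<otimes>\<^bsub>BS12\<^esub> bs_a [^]\<^bsub>BS12\<^esub> x) \<otimes>\<^bsub>BS12\<^esub>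
      (bs_b [^]\<^bsub>BS12\<^esub> n \<otimes>\<^bsub>BS12\<^esub> bs_a [^]\<^bsub>BS12\<^esub> y) =
    bs_b [^]\<^bsub>BS12\<^esub> m \<otimes>\<^bsub>BS12\<^esub>
      (bs_a [^]\<^bsub>BS12\<^esub> x \<otimes>\<^bsub>BS12\<^esub> bs_b [^]\<^bsub>BS12\<^esub> n) \<otimes>\<^bsub>BS12\<^esub> bs_a [^]\<^bsub>BS12\<^esub> y"
    by (simp add: BS12.m_assoc)
  also have "\<dots> = (bs_b [^]\<^bsub>BS12\<^esub> m \<otimes>\<^bsub>BS12\<^esub> bs_b [^]\<^bsub>BS12\<^esub> n) \<otimes>\<^bsub>BS12\<^esub>
      (bs_a [^]\<^bsub>BS12\<^esub> (2 ^ n * x) \<otimes>\<^bsub>BS12\<^esub> bs_a [^]\<^bsub>BS12\<^esub> y)"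
    unfolding bs_a_pow_mult_bs_b_pow by (simp add: BS12.m_assoc)
  finally show ?thesis
    by (simp add: BS12.nat_pow_mult BS12.int_pow_mult[symmetric] add.commute)
qed

section \<open>Product sets\<close>

lemma ba_set_eq_image:
  "ba_set m A = (\<lambda>x. bs_b [^]\<^bsub>BS12\<^esub> m \<otimes>\<^bsub>BS12\<^esub> bs_a [^]\<^bsub>BS12\<^esub> x) ` A"
  by (auto simp: ba_set_def)

lemma card_ba_set: "card (ba_set m A) = card A"
  using inj_bs_a_pow by (auto simp: ba_set_eq_image inj_on_def intro!: card_image)

text \<open>The exponents from the left factor are the dilated ones, since they must pass the power
  of \<open>b\<close> in the right factor.\<close>

lemma ba_set_mult:
  "ba_set m A <#>\<^bsub>BS12\<^esub> ba_set n B = ba_set (m + n) (sumset B (dilate (2 ^ n) A))"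
  unfolding ba_set_eq_image set_mult_def sumset_eq_image dilate_eq_image
  by (force simp: ba_mult_ba)

theorem corollary2:
  fixes S :: "bs_gen word set set" and A :: "int set" and m k :: nat
  assumes "S \<subseteq> carrier BS12" and "finite S" and "k = card S" and "k \<ge> 1"
    and "m \<ge> 2" and "finite A" and "S = ba_set m A"
  shows "S <#>\<^bsub>BS12\<^esub> S = ba_set (2 * m) (sumset A (dilate (2 ^ m) A)) \<and>
    card (S <#>\<^bsub>BS12\<^esub> S) = card (sumset A (dilate (2 ^ m) A)) \<and>
    int (card (sumset A (dilate (2 ^ m) A))) \<ge> max (4 * int k - 4) 1 \<and>
    max (4 * int k - 4) 1 \<ge> 3 * int k - 2"
proof -
  have k: "k = card A" using assms by (simp add: card_ba_set)
  have square: "S <#>\<^bsub>BS12\<^esub> S = ba_set (2 * m) (sumset A (dilate (2 ^ m) A))"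
    using ba_set_mult[of m A m A] assms by (simp add: mult_2)
  \<comment> \<open>Nonemptiness supplies the 1 in the maximum, which matters for
    \<open>k = 1\<close>, where \<open>4 * k - 4\<close> vanishes.\<close>
  have "A \<noteq> {}" using k assms by auto
  then have "sumset A (dilate (2 ^ m) A) \<noteq> {}" by (auto simp: sumset_def dilate_def)
  then have "card (sumset A (dilate (2 ^ m) A)) > 0"
    using assms by (simp add: card_gt_0_iff)
  then have "int (card (sumset A (dilate (2 ^ m) A))) \<ge> max (4 * int k - 4) 1"
    using card_sumset_dilate_ge[of m A] assms k by simp
  moreover have "max (4 * int k - 4) 1 \<ge> 3 * int k - 2"
    using \<open>k \<ge> 1\<close> by linarith
  ultimately show ?thesis
    by (simp add: square card_ba_set)
qed

end
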